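(* As $n\to\infty$ through the natural numbers, the coefficients $a_k$ in the asymptotic expansion $$n!\asymp\sqrt{2\pi n}\,e^{-n}n^n\Big(\sum_{k\ge 0}\frac{a_k}{n^k}\Big)$$ are given, for every integer $k\ge 0$, by $$a_k=\frac{1}{2^k\,k!}\,\partial^{2k}\big(L^{-\frac{2k+1}{2}}\big)(0),\qquad\text{where}\qquad L(x)=2\,\frac{-\log(1+x)+x}{x^2}=2\sum_{j\ge 0}\frac{(-1)^j x^j}{j+2}.$$
   Context: $\partial^k f$ denotes the $k$-th derivative of a function $f$ with respect to its variable. The function $L$ is defined near $x=0$ (for $|x|<1$) by its power series, so $L(0)=1$. The asymptotic expansion is understood in the following sense: for any given integer $N\ge 0$, $$n!=\sqrt{2\pi n}\,e^{-n}n^n\Big(\sum_{k=0}^{N}\frac{a_k}{n^k}+R_{N+1}\Big),\qquad R_{N+1}=R_{N+1}(n)=O\Big(\frac{1}{n^{N+1}}\Big)\ \text{ as } n\to\infty.$$ Such an expansion exists and its coefficients are unique. *)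

theory Defs
  imports "HOL-Analysis.Analysis" "HOL-Library.Landau_Symbols"
begin

text \<open>The prefactor vanishes at \<open>n = 0\<close>, so the identity is only required for \<open>n > 0\<close>.\<close>

definition stirling_expansion :: "(nat \<Rightarrow> real) \<Rightarrow> bool" where
  "stirling_expansion a \<longleftrightarrow>
     (\<forall>N. \<exists>R :: nat \<Rightarrow> real.
        (\<forall>n>0. fact n = sqrt (2 * pi * real n) * exp (- real n) * real n ^ n *
                  ((\<Sum>k\<le>N. a k / real n ^ k) + R n)) \<and>
        R \<in> O(\<lambda>n. 1 / real n ^ (N + 1)))"

text \<open>The value is meaningful only where the series converges; only \<open>\<bar>x\<bar> < 1\<close> is used.\<close>

definition L :: "real \<Rightarrow> real" where
  "L x = 2 * (\<Sum>j. (-1) ^ j * x ^ j / (real j + 2))"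

lemma L_sums_closed_form:
  fixes x :: real
  assumes "\<bar>x\<bar> < 1" "x \<noteq> 0"
  shows "(\<lambda>j. (-1) ^ j * x ^ j / (real j + 2)) sums ((- ln (1 + x) + x) / x\<^sup>2)"
proof -
  define g where "g = (\<lambda>n. - ((- x) ^ n) / real n)"
  have "g sums ln (1 + x)"
    unfolding g_def using ln_series'[OF assms(1)] by simp
  then have "(\<lambda>n. g (n + 2)) sums (ln (1 + x) - (\<Sum>i<2. g i))"
    by (rule sums_split_initial_segment)
  moreover have "(\<Sum>i<2. g i) = x"
    by (simp add: g_def numeral_2_eq_2)
  ultimately have "(\<lambda>n. g (n + 2)) sums (ln (1 + x) - x)" by simp
  then have "(\<lambda>n. g (n + 2) * (- 1 / x\<^sup>2)) sums ((ln (1 + x) - x) * (- 1 / x\<^sup>2))"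
    by (rule sums_mult2)
  moreover have "g (n + 2) * (- 1 / x\<^sup>2) = (-1) ^ n * x ^ n / (real n + 2)" for n
    using assms(2) by (simp add: g_def field_simps power2_eq_square flip: power_mult_distrib)
  moreover have "(ln (1 + x) - x) * (- 1 / x\<^sup>2) = (- ln (1 + x) + x) / x\<^sup>2"
    using assms(2) by (simp add: field_simps)
  ultimately show ?thesis by simp
qed

lemma L_closed_form:
  fixes x :: real
  assumes "\<bar>x\<bar> < 1" "x \<noteq> 0"
  shows "L x = 2 * ((- ln (1 + x) + x) / x\<^sup>2)"
  unfolding L_def using sums_unique[OF L_sums_closed_form[OF assms]] by simp

lemma L_0: "L 0 = 1"
proof -
  have "(\<Sum>j. (-1) ^ j * (0::real) ^ j / (real j + 2)) = (\<Sum>j\<in>{0}. (-1) ^ j * (0::real) ^ j / (real j + 2))"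
    by (rule suminf_finite) auto
  then show ?thesis by (simp add: L_def)
qed

end

theory Submission
  imports Defs "HOL-Probability.Distributions" "HOL-Complex_Analysis.Laurent_Convergence"
    "HOL-Real_Asymp.Real_Asymp"
begin

text \<open>
  The proof is Laplace's method, with the change of variables made explicit on the level of
  formal power series. Substituting \<open>t = n (1 + x)\<close> in \<open>n! = \<integral> t^n e^(-t) dt\<close> gives
  \<open>n! e^n / n^(n+1) = \<integral> K(x)^n dx\<close>, where \<open>K(x) = (1 + x) e^(-x)\<close> for \<open>x \<ge> -1\<close>. Near the maximum
  at \<open>0\<close> one has \<open>K(x) = exp (- u(x)^2 / 2)\<close> with \<open>u(x) = x * sqrt (L x)\<close>, because
  \<open>x^2 L(x) = 2 (x - ln (1 + x))\<close>; away from it \<open>K\<close> is bounded by some \<open>\<rho> < 1\<close>, so that part of the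
  integral is exponentially small.

  Let \<open>V\<close> be the power series of \<open>sqrt (L x)\<close>, let \<open>U = X V\<close>, and let \<open>P\<close> be the derivative of the
  compositional inverse of \<open>U\<close>. Then \<open>P(U) U' = 1\<close>, so the truncation \<open>Q\<close> of \<open>P\<close> to degree less
  than \<open>M\<close> satisfies \<open>1 = Q(u(x)) u'(x) + O(x^M)\<close>. Inserting \<open>Q(u(x)) u'(x)\<close> into the integral
  near \<open>0\<close> and substituting \<open>v = u(x)\<close> reduces it to Gaussian moments:
  \<open>\<integral> K^n = (\<Sum>j<M. P_j \<integral> v^j exp (- n v^2 / 2) dv) + O(n^(-(M+1)/2))\<close>
  (\<open>laplace_expansion\<close>). Working with \<open>Q\<close> avoids any analytic inverse of \<open>u\<close>. Odd
  moments vanish, and the even ones produce the factors \<open>(2k)! / (2^k k!)\<close> and \<open>n^(-k)\<close>.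

  Lagrange inversion identifies \<open>P_k\<close> as the coefficient of \<open>X^k\<close> in \<open>V^(-(k+1))\<close>
  (\<open>lagrange_inversion\<close>); for even index \<open>2k\<close> this is the Taylor coefficient of
  \<open>L^(-(2k+1)/2)\<close> of order \<open>2k\<close>. So the stated numbers are coefficients of an expansion, and since
  such coefficients are unique, both directions of the equivalence follow.
\<close>

section \<open>Power series expansions of real functions\<close>

lemma fps_nth_higher_deriv_real:
  fixes f :: "real \<Rightarrow> real"
  assumes "f has_fps_expansion F"
  shows "(deriv ^^ n) f 0 = fact n * fps_nth F n"
proof -
  have "(deriv ^^ n) f has_fps_expansion (fps_deriv ^^ n) F"
    by (induction n) (use assms in \<open>auto intro: has_fps_expansion_deriv\<close>)
  then have "eval_fps ((fps_deriv ^^ n) F) 0 = (deriv ^^ n) f 0"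
    by (auto simp: has_fps_expansion_def dest: eventually_nhds_x_imp_x)
  then show ?thesis
    by (simp add: eval_fps_at_0 fps_0th_higher_deriv)
qed

text \<open>
  The real parts of the Taylor coefficients of a complex extension serve as the coefficients of
  the real function.
\<close>

lemma real_has_fps_expansion_if_analytic_extension:
  fixes f :: "real \<Rightarrow> real" and F :: "complex \<Rightarrow> complex"
  assumes "F analytic_on {0}"
    and "eventually (\<lambda>x. F (of_real x) = of_real (f x)) (nhds 0)"
  shows "\<exists>V. f has_fps_expansion V"
proof -
  define G where "G = fps_expansion F 0"
  have G: "F has_fps_expansion G"
    unfolding G_def using assms(1) by (rule analytic_at_imp_has_fps_expansion_0)
  define V where "V = Abs_fps (\<lambda>n. Re (fps_nth G n))"
  have lim: "filterlim (of_real :: real \<Rightarrow> complex) (nhds 0) (nhds 0)"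
    using tendsto_of_real[OF filterlim_ident[of "nhds (0::real)"]] by simp
  have "eventually (\<lambda>z. z \<in> eball (0::complex) (fps_conv_radius G)) (nhds 0)"
    using G by (intro eventually_nhds_in_open) (auto simp: has_fps_expansion_def zero_ereal_def)
  moreover have "eventually (\<lambda>z. eval_fps G z = F z) (nhds 0)"
    using G by (auto simp: has_fps_expansion_def)
  ultimately have "eventually (\<lambda>z. (\<lambda>n. fps_nth G n * z ^ n) sums F z) (nhds 0)"
    by eventually_elim (metis sums_eval_fps in_eball_iff dist_0_norm)
  then have "eventually (\<lambda>x::real. (\<lambda>n. fps_nth G n * of_real x ^ n) sums F (of_real x)) (nhds 0)"
    using lim by (rule eventually_compose_filterlim)
  then have "eventually (\<lambda>x. (\<lambda>n. fps_nth V n * x ^ n) sums f x) (nhds 0)"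
    using assms(2)
  proof eventually_elim
    case (elim x)
    then have "(\<lambda>n. Re (fps_nth G n * of_real x ^ n)) sums Re (of_real (f x))"
      by (metis sums_Re)
    moreover have "Re (fps_nth G n * of_real x ^ n) = fps_nth V n * x ^ n" for n
      by (simp add: V_def flip: of_real_power)
    ultimately show ?case by (simp only: Re_complex_of_real)
  qed
  then show ?thesis
    using has_fps_expansionI by blast
qed

lemma has_fps_expansion_zero_prefix_bound:
  fixes f :: "real \<Rightarrow> real"
  assumes f: "f has_fps_expansion F" and F: "\<And>i. i < M \<Longrightarrow> fps_nth F i = 0"
  obtains C \<delta> where "\<delta> > 0" "\<And>x. \<bar>x\<bar> \<le> \<delta> \<Longrightarrow> \<bar>f x\<bar> \<le> C * \<bar>x\<bar> ^ M"
proof -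
  define G where "G = fps_shift M F"
  have F_eq: "F = fps_X ^ M * G"
    using F by (auto simp: fps_eq_iff fps_X_power_mult_nth G_def)
  have radG: "fps_conv_radius G = fps_conv_radius F" by (simp add: G_def)
  have rad: "fps_conv_radius G > 0" using f radG by (simp add: has_fps_expansion_def)
  have "isCont (eval_fps G) 0"
    using has_fps_expansion_imp_continuous[OF eval_fps_has_fps_expansion[OF rad], of UNIV] by simp
  then have "((\<lambda>x. \<bar>eval_fps G x\<bar>) \<longlongrightarrow> \<bar>eval_fps G 0\<bar>) (nhds 0)"
    by (intro tendsto_rabs) (simp add: isCont_def tendsto_nhds_iff)
  then have "eventually (\<lambda>x. \<bar>eval_fps G x\<bar> < \<bar>eval_fps G 0\<bar> + 1) (nhds 0)"
    by (rule order_tendstoD) simp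
  moreover have "eventually (\<lambda>x. x \<in> eball 0 (fps_conv_radius G)) (nhds (0::real))"
    using rad by (intro eventually_nhds_in_open) (auto simp: zero_ereal_def)
  moreover have "eventually (\<lambda>x. eval_fps F x = f x) (nhds 0)"
    using f by (simp add: has_fps_expansion_def)
  ultimately have "eventually (\<lambda>x. \<bar>f x\<bar> \<le> (\<bar>eval_fps G 0\<bar> + 1) * \<bar>x\<bar> ^ M) (nhds 0)"
  proof eventually_elim
    case (elim x)
    then have "f x = x ^ M * eval_fps G x"
      by (simp add: F_eq eval_fps_mult)
    then have "\<bar>f x\<bar> = \<bar>eval_fps G x\<bar> * \<bar>x\<bar> ^ M"
      by (simp add: abs_mult power_abs)
    also have "\<dots> \<le> (\<bar>eval_fps G 0\<bar> + 1) * \<bar>x\<bar> ^ M"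
      using elim(1) by (intro mult_right_mono) auto
    finally show ?case .
  qed
  then obtain e where "e > 0" "\<And>x. dist x 0 < e \<Longrightarrow> \<bar>f x\<bar> \<le> (\<bar>eval_fps G 0\<bar> + 1) * \<bar>x\<bar> ^ M"
    unfolding eventually_nhds_metric by blast
  then show ?thesis
    by (intro that[of "e / 2" "\<bar>eval_fps G 0\<bar> + 1"]) (auto simp: dist_real_def)
qed

section \<open>The square root of L\<close>

lemma L_pos:
  assumes "\<bar>x\<bar> < 1"
  shows "L x > 0"
proof (cases "x = 0")
  case False
  have "1 + x \<noteq> 1" "1 + x > 0" using False assms by auto
  then have "ln (1 + x) < (1 + x) - 1"
    using ln_less_self ln_eq_minus_one ln_le_minus_one by fastforce
  then show ?thesis
    using assms False by (simp add: L_closed_form)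
qed (simp add: L_0)

text \<open>
  The extension of \<open>sqrt (L x)\<close> to complex arguments is the principal square root of the complex
  power series of \<open>L\<close>, which has the value \<open>1\<close> at \<open>0\<close> and so stays off the branch cut.
\<close>

lemma sqrt_L_has_fps_expansion:
  obtains V where "(\<lambda>x. sqrt (L x)) has_fps_expansion V"
proof -
  define G :: "complex fps" where "G = Abs_fps (\<lambda>j. of_real (2 * (-1) ^ j / (real j + 2)))"
  have sums_G: "(\<lambda>j. fps_nth G j * of_real x ^ j) sums of_real (L x)" if "\<bar>x\<bar> < 1" for x :: real
  proof -
    have "(\<lambda>j. (-1) ^ j * x ^ j / (real j + 2)) sums (\<Sum>j. (-1) ^ j * x ^ j / (real j + 2))"
    proof (cases "x = 0")
      case False
      then show ?thesis using L_sums_closed_form[OF that] by (simp add: sums_iff)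
    next
      case True
      have "summable (\<lambda>j. (-1) ^ j * (0::real) ^ j / (real j + 2))"
        by (rule summable_finite[of "{0}"]) auto
      then show ?thesis using True by (simp add: summable_sums)
    qed
    then have "(\<lambda>j. 2 * ((-1) ^ j * x ^ j / (real j + 2))) sums L x"
      unfolding L_def by (rule sums_mult)
    then have "(\<lambda>j. of_real (2 * ((-1) ^ j * x ^ j / (real j + 2))) :: complex) sums of_real (L x)"
      by (simp only: sums_of_real_iff)
    then show ?thesis by (simp add: G_def mult.assoc)
  qed
  have rad: "fps_conv_radius G > 0"
  proof -
    have "summable (\<lambda>j. fps_nth G j * of_real (1/2) ^ j)"
      using sums_G[of "1/2"] by (auto simp: sums_iff)
    then have "fps_conv_radius G \<ge> norm (of_real (1/2) :: complex)"
      unfolding fps_conv_radius_def by (rule conv_radius_geI)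
    then show ?thesis by (auto intro: less_le_trans[rotated])
  qed
  have eval_G: "eval_fps G (of_real x) = of_real (L x)" if "\<bar>x\<bar> < 1" for x :: real
    using sums_G[OF that] by (simp add: eval_fps_def sums_iff)
  have "eval_fps G analytic_on {0}"
    using eval_fps_has_fps_expansion[OF rad] by (rule has_fps_expansion_imp_analytic_0)
  moreover have "csqrt analytic_on eval_fps G ` {0}"
  proof -
    have "eval_fps G 0 = 1" using eval_G[of 0] by (simp add: L_0)
    moreover have "csqrt analytic_on - \<real>\<^sub>\<le>\<^sub>0"
      by (subst analytic_on_open) (auto intro: holomorphic_intros)
    ultimately show ?thesis by (auto elim: analytic_on_subset)
  qed
  ultimately have "(csqrt \<circ> eval_fps G) analytic_on {0}"
    by (rule analytic_on_compose)
  moreover have "eventually (\<lambda>x. (csqrt \<circ> eval_fps G) (of_real x) = of_real (sqrt (L x))) (nhds 0)"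
  proof -
    have "eventually (\<lambda>x::real. x \<in> ball 0 1) (nhds 0)"
      by (rule eventually_nhds_in_open) auto
    then show ?thesis
      by eventually_elim
         (auto simp: eval_G csqrt_of_real_nonneg L_pos less_imp_le)
  qed
  ultimately have "\<exists>V. (\<lambda>x. sqrt (L x)) has_fps_expansion V"
    by (rule real_has_fps_expansion_if_analytic_extension)
  then show ?thesis using that by blast
qed

lemma higher_deriv_L_powr:
  assumes V: "(\<lambda>x. sqrt (L x)) has_fps_expansion V"
  shows "(deriv ^^ n) (\<lambda>x. L x powr (- (2 * real k + 1) / 2)) 0
       = fact n * fps_nth (inverse V ^ (2 * k + 1)) n"
proof (rule fps_nth_higher_deriv_real)
  have "fps_nth V 0 = sqrt (L 0)"
    using V by (auto simp: has_fps_expansion_def eval_fps_at_0 dest: eventually_nhds_x_imp_x)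
  then have "fps_nth V 0 \<noteq> 0" by (simp add: L_0)
  then have *: "(\<lambda>x. inverse (sqrt (L x)) ^ (2 * k + 1)) has_fps_expansion inverse V ^ (2 * k + 1)"
    using V by (intro has_fps_expansion_power has_fps_expansion_inverse)
  have "eventually (\<lambda>x::real. x \<in> ball 0 1) (nhds 0)"
    by (rule eventually_nhds_in_open) auto
  then have "eventually (\<lambda>x. inverse (sqrt (L x)) ^ (2 * k + 1) = L x powr (- (2 * real k + 1) / 2)) (nhds 0)"
  proof eventually_elim
    case (elim x)
    then have "L x > 0" by (intro L_pos) auto
    have "inverse (sqrt (L x)) ^ (2 * k + 1) = (L x powr (- 1 / 2)) ^ (2 * k + 1)"
      using \<open>L x > 0\<close> by (simp add: powr_minus powr_half_sqrt)
    also have "\<dots> = (L x powr (- 1 / 2)) powr real (2 * k + 1)"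
      using \<open>L x > 0\<close> by (intro powr_realpow[symmetric]) simp
    also have "\<dots> = L x powr ((- 1 / 2) * real (2 * k + 1))"
      by (rule powr_powr)
    also have "(- 1 / 2) * real (2 * k + 1) = - (2 * real k + 1) / 2"
      by (simp add: field_simps)
    finally show ?case .
  qed
  then show "(\<lambda>x. L x powr (- (2 * real k + 1) / 2)) has_fps_expansion inverse V ^ (2 * k + 1)"
    by (rule has_fps_expansion_cong[THEN iffD1, OF _ refl *])
qed

section \<open>Lagrange inversion\<close>

lemma fps_nth_compose_mult:
  fixes P U G :: "'a::comm_ring_1 fps"
  assumes "fps_nth U 0 = 0"
  shows "fps_nth ((P oo U) * G) k = (\<Sum>j\<le>k. fps_nth P j * fps_nth (U ^ j * G) k)"
proof -
  have "fps_nth ((P oo U) * G) k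
      = (\<Sum>i\<le>k. (\<Sum>j\<le>k. fps_nth P j * fps_nth (U ^ j) i) * fps_nth G (k - i))"
  proof -
    have "fps_nth (P oo U) i = (\<Sum>j\<le>k. fps_nth P j * fps_nth (U ^ j) i)" if "i \<le> k" for i
    proof -
      have "fps_nth (U ^ j) i = 0" if "i < j" for j
        using assms that by (rule startsby_zero_power_prefix[rule_format])
      then show ?thesis
        unfolding fps_compose_nth using that
        by (intro sum.mono_neutral_left) auto
    qed
    then show ?thesis
      by (simp add: fps_mult_nth atMost_atLeast0)
  qed
  also have "\<dots> = (\<Sum>j\<le>k. fps_nth P j * fps_nth (U ^ j * G) k)"
    by (simp add: fps_mult_nth atMost_atLeast0 sum_distrib_left sum_distrib_right mult.assoc)
       (rule sum.swap)
  finally show ?thesis .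
qed

text \<open>
  In terms of Laurent series with \<open>U = X V\<close>, this says that \<open>U^(j-k-1) U'\<close> has residue \<open>1\<close> if
  \<open>j = k\<close> and \<open>0\<close> otherwise, being the derivative of \<open>U^(j-k) / (j-k)\<close> in the latter case.
\<close>

lemma fps_nth_residue_delta:
  fixes V :: "'a::field_char_0 fps"
  assumes V0: "fps_nth V 0 \<noteq> 0" and jk: "j \<le> k"
  shows "fps_nth ((fps_X * V) ^ j * (fps_deriv (fps_X * V) * inverse V ^ Suc k)) k
       = (if j = k then 1 else 0)"
proof -
  define W where "W = inverse V"
  have VW: "V * W = 1"
    using V0 by (simp add: W_def inverse_mult_eq_1')
  define m where "m = k - j"
  have k: "k = j + m" using jk by (simp add: m_def)
  have dW: "fps_deriv W = - fps_deriv V * W\<^sup>2"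
    using V0 by (simp add: W_def fps_inverse_deriv)
  have "(fps_X * V) ^ j * (fps_deriv (fps_X * V) * W ^ Suc k)
      = fps_X ^ j * ((V * W) ^ j * (V * W * W ^ m + fps_X * (fps_deriv V * W ^ Suc m)))"
    by (simp add: k power_add power_mult_distrib algebra_simps)
  also have "\<dots> = fps_X ^ j * (W ^ m + fps_X * (fps_deriv V * W ^ Suc m))"
    by (simp add: VW)
  finally have eq: "fps_nth ((fps_X * V) ^ j * (fps_deriv (fps_X * V) * W ^ Suc k)) k
      = fps_nth (W ^ m + fps_X * (fps_deriv V * W ^ Suc m)) m"
    by (simp add: k fps_X_power_mult_nth)
  show ?thesis
  proof (cases "m = 0")
    case True
    then show ?thesis using eq k by (simp add: W_def)
  next
    case False
    have "fps_deriv (W ^ m) = of_nat m * (fps_deriv W * W ^ (m - 1))"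
      by (simp add: fps_deriv_power' mult.assoc)
    also have "\<dots> = - of_nat m * (fps_deriv V * W ^ Suc m)"
      using False by (cases m) (simp_all add: dW power2_eq_square algebra_simps)
    finally have "fps_nth (fps_deriv (W ^ m)) (m - 1) = - of_nat m * fps_nth (fps_deriv V * W ^ Suc m) (m - 1)"
      by (simp add: fps_mult_of_nat_nth mult.assoc)
    then have "of_nat m * fps_nth (W ^ m) m = of_nat m * - fps_nth (fps_deriv V * W ^ Suc m) (m - 1)"
      using False by simp
    then have "fps_nth (W ^ m) m = - fps_nth (fps_deriv V * W ^ Suc m) (m - 1)"
      using False by (subst (asm) mult_left_cancel) auto
    then show ?thesis using eq k False by (simp add: W_def)
  qed
qed

text \<open>
  The coefficient formula follows by multiplying \<open>P(U) U' = 1\<close> with \<open>V^(-(k+1))\<close> and comparing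
  coefficients of \<open>X^k\<close>: on the left, only the term of \<open>P\<close> with index \<open>k\<close> survives.
\<close>

lemma lagrange_inversion:
  fixes V :: "'a::field_char_0 fps"
  assumes V0: "fps_nth V 0 \<noteq> 0"
  defines "U \<equiv> fps_X * V"
  defines "P \<equiv> fps_deriv (fps_inv U)"
  shows "(P oo U) * fps_deriv U = 1"
    and "fps_nth P k = fps_nth (inverse V ^ Suc k) k"
proof -
  have U: "fps_nth U 0 = 0" "fps_nth U 1 \<noteq> 0"
    using V0 by (simp_all add: U_def)
  have "fps_deriv (fps_inv U oo U) = (P oo U) * fps_deriv U"
    unfolding P_def using U(1) by (rule fps_compose_deriv)
  then show *: "(P oo U) * fps_deriv U = 1"
    by (simp add: fps_inv[OF U])
  have "fps_nth (inverse V ^ Suc k) k = fps_nth ((P oo U) * (fps_deriv U * inverse V ^ Suc k)) k"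
    by (simp add: * flip: mult.assoc del: power_Suc)
  also have "\<dots> = (\<Sum>j\<le>k. fps_nth P j * (if j = k then 1 else 0))"
    unfolding fps_nth_compose_mult[OF U(1)]
    by (intro sum.cong refl arg_cong2[of _ _ _ _ "(*)"]) 
       (use fps_nth_residue_delta[OF V0] in \<open>simp add: U_def\<close>)
  also have "\<dots> = fps_nth P k"
    by (simp add: if_distrib[of "(*) _"] cong: if_cong)
  finally show "fps_nth P k = fps_nth (inverse V ^ Suc k) k"
    by (rule sym)
qed

section \<open>Laplace expansion of integrals of powers\<close>

lemma geometric_bigo_power_sqrt:
  fixes q :: real
  assumes "0 \<le> q" "q < 1"
  shows "(\<lambda>n. q ^ (n - 1)) \<in> O(\<lambda>n. 1 / sqrt (real n) ^ k)"
proof (cases "q = 0")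
  case True
  have "eventually (\<lambda>n. q ^ (n - 1) = 0) sequentially"
    using eventually_gt_at_top[of 1] by eventually_elim (auto simp: True)
  then show ?thesis
    by (intro bigoI[of _ 1]) (auto elim!: eventually_mono simp: power_0_left)
next
  case False
  then have q: "0 < q" using assms by simp
  show ?thesis using q assms(2) by real_asymp
qed

lemma has_bochner_integral_gaussian_moment:
  assumes "n > 0"
  shows "has_bochner_integral lborel (\<lambda>v. v ^ j * exp (- real n * v\<^sup>2 / 2))
    (if even j then sqrt (2 * pi / real n) * fact j / (2 ^ (j div 2) * fact (j div 2) * real n ^ (j div 2))
     else 0)"
proof -
  define \<sigma> where "\<sigma> = 1 / sqrt (real n)"
  have \<sigma>: "\<sigma> > 0" "\<sigma>\<^sup>2 = 1 / real n"
    using assms by (simp_all add: \<sigma>_def power_divide)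
  have "has_bochner_integral lborel (\<lambda>v. normal_density 0 \<sigma> v * v ^ j)
      (if even j then fact j / ((2 * real n) ^ (j div 2) * fact (j div 2)) else 0)"
    using normal_moment_even[OF \<sigma>(1), of 0 "j div 2"] normal_moment_odd[OF \<sigma>(1), of 0 "j div 2"]
    by (cases "even j") (simp_all add: \<sigma> odd_two_times_div_two_succ)
  then have "has_bochner_integral lborel (\<lambda>v. sqrt (2 * pi / real n) * (normal_density 0 \<sigma> v * v ^ j))
      (sqrt (2 * pi / real n) * (if even j then fact j / ((2 * real n) ^ (j div 2) * fact (j div 2)) else 0))"
    by (rule has_bochner_integral_mult_right)
  moreover have "sqrt (2 * pi / real n) * (normal_density 0 \<sigma> v * v ^ j) = v ^ j * exp (- real n * v\<^sup>2 / 2)" for v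
    using assms by (simp add: normal_density_def \<sigma>)
  ultimately have "has_bochner_integral lborel (\<lambda>v. v ^ j * exp (- real n * v\<^sup>2 / 2))
      (sqrt (2 * pi / real n) * (if even j then fact j / ((2 * real n) ^ (j div 2) * fact (j div 2)) else 0))"
    by (simp only:)
  also have "sqrt (2 * pi / real n) * (if even j then fact j / ((2 * real n) ^ (j div 2) * fact (j div 2)) else 0)
      = (if even j then sqrt (2 * pi / real n) * fact j / (2 ^ (j div 2) * fact (j div 2) * real n ^ (j div 2)) else 0)"
    by (simp add: power_mult_distrib mult_ac)
  finally show ?thesis .
qed

lemma scaled_gaussian_abs_moment:
  fixes c :: real
  assumes "n > 0" "c > 0"
  shows "has_bochner_integral lborel (\<lambda>x. \<bar>x\<bar> ^ M * exp (- real n * (c * x)\<^sup>2 / 2))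
    ((\<integral>v. \<bar>v\<bar> ^ M * exp (- v\<^sup>2 / 2) \<partial>lborel) / c ^ Suc M * (1 / sqrt (real n) ^ Suc M))"
proof -
  have "integrable lborel (\<lambda>v. sqrt (2 * pi) * (std_normal_density v * \<bar>v\<bar> ^ M))"
    by (intro integrable_mult_right integrable_std_normal_moment_abs)
  then have "integrable lborel (\<lambda>v::real. \<bar>v\<bar> ^ M * exp (- v\<^sup>2 / 2))"
    by (simp add: std_normal_density_def mult.commute)
  then have *: "has_bochner_integral lborel (\<lambda>v::real. \<bar>v\<bar> ^ M * exp (- v\<^sup>2 / 2))
      (\<integral>v. \<bar>v\<bar> ^ M * exp (- v\<^sup>2 / 2) \<partial>lborel)"
    by (rule has_bochner_integral_integrable)
  define s where "s = c * sqrt (real n)"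
  have s: "s > 0" using assms by (simp add: s_def)
  have "has_bochner_integral lborel (\<lambda>x. \<bar>0 + s * x\<bar> ^ M * exp (- (0 + s * x)\<^sup>2 / 2))
      ((\<integral>v. \<bar>v\<bar> ^ M * exp (- v\<^sup>2 / 2) \<partial>lborel) /\<^sub>R \<bar>s\<bar>)"
    using s by (intro lborel_has_bochner_integral_real_affine_iff[THEN iffD1, OF _ *]) simp
  moreover have "r /\<^sub>R \<bar>s\<bar> = r / s" for r :: real
    using s by (simp add: field_simps)
  ultimately have "has_bochner_integral lborel (\<lambda>x. \<bar>s * x\<bar> ^ M * exp (- (s * x)\<^sup>2 / 2))
      ((\<integral>v. \<bar>v\<bar> ^ M * exp (- v\<^sup>2 / 2) \<partial>lborel) / s)"
    by (simp only: add_0_left)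
  then have "has_bochner_integral lborel (\<lambda>x. 1 / s ^ M * (\<bar>s * x\<bar> ^ M * exp (- (s * x)\<^sup>2 / 2)))
      (1 / s ^ M * ((\<integral>v. \<bar>v\<bar> ^ M * exp (- v\<^sup>2 / 2) \<partial>lborel) / s))"
    by (rule has_bochner_integral_mult_right)
  moreover have "1 / s ^ M * (\<bar>s * x\<bar> ^ M * exp (- (s * x)\<^sup>2 / 2)) = \<bar>x\<bar> ^ M * exp (- real n * (c * x)\<^sup>2 / 2)" for x
  proof -
    have "(s * x)\<^sup>2 = real n * (c * x)\<^sup>2"
      by (simp add: s_def power_mult_distrib)
    then show ?thesis
      using s by (simp add: abs_mult power_mult_distrib)
  qed
  moreover have "1 / s ^ M * ((\<integral>v. \<bar>v\<bar> ^ M * exp (- v\<^sup>2 / 2) \<partial>lborel) / s)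
      = (\<integral>v. \<bar>v\<bar> ^ M * exp (- v\<^sup>2 / 2) \<partial>lborel) / c ^ Suc M * (1 / sqrt (real n) ^ Suc M)"
    by (simp add: s_def power_mult_distrib)
  ultimately show ?thesis
    by (simp only:)
qed

text \<open>
  Outside \<open>{a..b}\<close> all but one of the \<open>n\<close> factors \<open>w\<close> are bounded by \<open>\<rho>\<close>; the remaining factor
  keeps the integral finite. The weight \<open>g\<close> allows the same bound to serve for powers of the
  integrand and for polynomials times powers of a Gaussian.
\<close>

lemma laplace_tail_bound:
  fixes w g :: "real \<Rightarrow> real"
  assumes w: "\<And>x. 0 \<le> w x" and \<rho>: "0 \<le> \<rho>"
    and out: "\<And>x. x \<notin> {a..b} \<Longrightarrow> w x \<le> \<rho>"
    and gw: "integrable lborel (\<lambda>x. g x * w x)"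
    and gwn: "integrable lborel (\<lambda>x. g x * w x ^ n)" and n: "n > 0"
  shows "\<bar>(\<integral>x. g x * w x ^ n \<partial>lborel) - (LINT x:{a..b}|lborel. g x * w x ^ n)\<bar>
      \<le> \<rho> ^ (n - 1) * (\<integral>x. \<bar>g x * w x\<bar> \<partial>lborel)"
proof -
  have "integrable lborel (\<lambda>x. indicator {a..b} x *\<^sub>R (g x * w x ^ n))"
    using gwn by (rule integrable_mult_indicator[rotated]) auto
  then have "(\<integral>x. g x * w x ^ n \<partial>lborel) - (LINT x:{a..b}|lborel. g x * w x ^ n)
      = (\<integral>x. g x * w x ^ n - indicator {a..b} x *\<^sub>R (g x * w x ^ n) \<partial>lborel)" (is "?l = (\<integral>x. ?h x \<partial>lborel)")
    unfolding set_lebesgue_integral_def using gwn by simp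
  also have "\<bar>\<dots>\<bar> \<le> (\<integral>x. \<rho> ^ (n - 1) * \<bar>g x * w x\<bar> \<partial>lborel)"
  proof (rule integral_abs_bound_integral)
    show "integrable lborel ?h"
      using gwn by (intro Bochner_Integration.integrable_diff integrable_mult_indicator) auto
    show "integrable lborel (\<lambda>x. \<rho> ^ (n - 1) * \<bar>g x * w x\<bar>)"
      using gw by (intro integrable_mult_right integrable_abs)
    fix x :: real
    show "\<bar>?h x\<bar> \<le> \<rho> ^ (n - 1) * \<bar>g x * w x\<bar>"
    proof (cases "x \<in> {a..b}")
      case False
      have "w x ^ n = w x ^ (n - 1) * w x"
        using n by (cases n) auto
      then have "\<bar>?h x\<bar> = w x ^ (n - 1) * \<bar>g x * w x\<bar>"
        using False w[of x] by (simp add: abs_mult power_abs)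
      also have "\<dots> \<le> \<rho> ^ (n - 1) * \<bar>g x * w x\<bar>"
        using w[of x] out[OF False] by (intro mult_right_mono power_mono) auto
      finally show ?thesis .
    qed (use \<rho> in auto)
  qed
  finally show ?thesis by simp
qed

lemma gaussian_polynomial_integrable:
  "integrable lborel (\<lambda>v::real. (\<Sum>j<M. p j * v ^ j) * exp (- v\<^sup>2 / 2) ^ n)"  if "n > 0"
proof -
  have "integrable lborel (\<lambda>v. \<Sum>j<M. p j * (v ^ j * exp (- real n * v\<^sup>2 / 2)))"
    using has_bochner_integral_gaussian_moment[OF that]
    by (intro Bochner_Integration.integrable_sum integrable_mult_right) (auto simp: has_bochner_integral_iff)
  moreover have "exp (- v\<^sup>2 / 2) ^ n = exp (- real n * v\<^sup>2 / 2)" for v :: real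
    by (simp flip: exp_of_nat_mult)
  ultimately show ?thesis
    by (simp add: sum_distrib_right mult.assoc)
qed

text \<open>
  The hypothesis on \<open>p\<close> says that the polynomial with these coefficients approximates the derivative
  of the inverse function of \<open>u\<close> to order \<open>M\<close>, expressed without the inverse function. The error
  has three parts: the tail of \<open>w^n\<close>, the approximation error near \<open>0\<close>, which is controlled by a
  scaled Gaussian moment, and the tails of the Gaussian moments. Injectivity of \<open>u\<close> is not required:
  the substitution rule only involves the values of \<open>u\<close> at the endpoints.
\<close>

lemma laplace_expansion:
  fixes w u u' :: "real \<Rightarrow> real" and p :: "nat \<Rightarrow> real"
  assumes w: "\<And>x. 0 \<le> w x" and \<rho>: "0 \<le> \<rho>" "\<rho> < 1" and \<delta>: "\<delta> > 0"
    and wn: "\<And>n. n > 0 \<Longrightarrow> integrable lborel (\<lambda>x. w x ^ n)"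
    and out: "\<And>x. x \<notin> {-\<delta>..\<delta>} \<Longrightarrow> w x \<le> \<rho>"
    and ins: "\<And>x. x \<in> {-\<delta>..\<delta>} \<Longrightarrow> w x = exp (- (u x)\<^sup>2 / 2)"
    and du: "\<And>x. x \<in> {-\<delta>..\<delta>} \<Longrightarrow> (u has_real_derivative u' x) (at x)"
    and cu': "continuous_on {-\<delta>..\<delta>} u'"
    and c: "c > 0" "\<And>x. x \<in> {-\<delta>..\<delta>} \<Longrightarrow> c * \<bar>x\<bar> \<le> \<bar>u x\<bar>"
    and sgn: "u (-\<delta>) < 0" "0 < u \<delta>"
    and approx: "\<And>x. x \<in> {-\<delta>..\<delta>} \<Longrightarrow> \<bar>1 - (\<Sum>j<M. p j * u x ^ j) * u' x\<bar> \<le> C * \<bar>x\<bar> ^ M"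
  shows "(\<lambda>n. (\<integral>x. w x ^ n \<partial>lborel) - (\<Sum>j<M. p j * (\<integral>v. v ^ j * exp (- real n * v\<^sup>2 / 2) \<partial>lborel)))
           \<in> O(\<lambda>n. 1 / sqrt (real n) ^ Suc M)"
proof -
  define P where "P = (\<lambda>v. \<Sum>j<M. p j * v ^ j)"
  define \<gamma> where "\<gamma> = (\<lambda>v::real. exp (- v\<^sup>2 / 2))"
  define d where "d = min (u \<delta>) (- u (- \<delta>))"
  have d: "d > 0" using sgn by (simp add: d_def)
  define A where "A = (\<integral>x. \<bar>1 * w x\<bar> \<partial>lborel)"
  define B where "B = C * ((\<integral>v. \<bar>v\<bar> ^ M * exp (- v\<^sup>2 / 2) \<partial>lborel) / c ^ Suc M)"
  define D where "D = (\<integral>v. \<bar>P v * \<gamma> v\<bar> \<partial>lborel)"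
  have \<gamma>_pow: "\<gamma> v ^ n = exp (- real n * v\<^sup>2 / 2)" for v n
    by (simp add: \<gamma>_def flip: exp_of_nat_mult)
  have cu: "continuous_on {-\<delta>..\<delta>} u"
    using du by (meson DERIV_continuous_on has_field_derivative_at_within)
  have P_int: "integrable lborel (\<lambda>v. P v * \<gamma> v ^ n)" if "n > 0" for n
    unfolding P_def \<gamma>_def using gaussian_polynomial_integrable[OF that] .
  have bound: "\<bar>(\<integral>x. w x ^ n \<partial>lborel) - (\<Sum>j<M. p j * (\<integral>v. v ^ j * exp (- real n * v\<^sup>2 / 2) \<partial>lborel))\<bar>
      \<le> A * \<rho> ^ (n - 1) + B * (1 / sqrt (real n) ^ Suc M) + D * \<gamma> d ^ (n - 1)" if n: "n > 0" for n
  proof -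
    have 1: "\<bar>(\<integral>x. w x ^ n \<partial>lborel) - (LINT x:{-\<delta>..\<delta>}|lborel. w x ^ n)\<bar> \<le> \<rho> ^ (n - 1) * A"
      using laplace_tail_bound[where g = "\<lambda>_. 1" and w = w and n = n, OF w \<rho>(1) out _ _ n] wn[of 1] wn[OF n]
      by (simp add: A_def)
    have "(LINT x:{-\<delta>..\<delta>}|lborel. w x ^ n) = (LINT x:{-\<delta>..\<delta>}|lborel. \<gamma> (u x) ^ n)"
      by (intro set_lebesgue_integral_cong) (auto simp: ins \<gamma>_def)
    note 1 = 1[unfolded this]
    \<comment> \<open>Near \<open>0\<close>, insert \<open>P (u x) * u' x\<close> in place of \<open>1\<close> and substitute \<open>v = u x\<close>.\<close>
    have ints: "set_integrable lborel {-\<delta>..\<delta>} (\<lambda>x. \<gamma> (u x) ^ n)"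
               "set_integrable lborel {-\<delta>..\<delta>} (\<lambda>x. u' x * (P (u x) * \<gamma> (u x) ^ n))"
      unfolding \<gamma>_def P_def
      by (intro borel_integrable_atLeastAtMost' continuous_intros cu cu'; simp)+
    have "(LINT x:{-\<delta>..\<delta>}|lborel. u' x * (P (u x) * \<gamma> (u x) ^ n)) = (LBINT x=-\<delta>..\<delta>. u' x *\<^sub>R (P (u x) * \<gamma> (u x) ^ n))"
      using \<delta> by (subst interval_integral_Icc) auto
    also have "\<dots> = (LBINT v=u (-\<delta>)..u \<delta>. P v * \<gamma> v ^ n)"
    proof (rule interval_integral_substitution_finite)
      show "continuous_on (u ` {- \<delta>..\<delta>}) (\<lambda>v. P v * \<gamma> v ^ n)"
        unfolding P_def \<gamma>_def by (intro continuous_intros) auto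
    qed (use \<delta> cu' du in \<open>auto intro: has_field_derivative_at_within\<close>)
    also have "\<dots> = (LINT v:{u (-\<delta>)..u \<delta>}|lborel. P v * \<gamma> v ^ n)"
      using sgn by (intro interval_integral_Icc) auto
    finally have subst: "(LINT x:{-\<delta>..\<delta>}|lborel. u' x * (P (u x) * \<gamma> (u x) ^ n))
        = (LINT v:{u (-\<delta>)..u \<delta>}|lborel. P v * \<gamma> v ^ n)" .
    have "\<bar>(LINT x:{-\<delta>..\<delta>}|lborel. \<gamma> (u x) ^ n) - (LINT x:{-\<delta>..\<delta>}|lborel. u' x * (P (u x) * \<gamma> (u x) ^ n))\<bar>
        = \<bar>\<integral>x. indicator {-\<delta>..\<delta>} x * ((1 - P (u x) * u' x) * \<gamma> (u x) ^ n) \<partial>lborel\<bar>"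
      using ints unfolding set_lebesgue_integral_def set_integrable_def
      by (subst Bochner_Integration.integral_diff[symmetric]) (auto simp: algebra_simps)
    also have "\<dots> \<le> (\<integral>x. C * (\<bar>x\<bar> ^ M * exp (- real n * (c * x)\<^sup>2 / 2)) \<partial>lborel)"
    proof (rule integral_abs_bound_integral)
      show "integrable lborel (\<lambda>x. indicator {-\<delta>..\<delta>} x * ((1 - P (u x) * u' x) * \<gamma> (u x) ^ n))"
        using Bochner_Integration.integrable_diff[OF ints[unfolded set_integrable_def]] by (simp add: algebra_simps)
      show "integrable lborel (\<lambda>x. C * (\<bar>x\<bar> ^ M * exp (- real n * (c * x)\<^sup>2 / 2)))"
        using scaled_gaussian_abs_moment[OF n c(1)] by (intro integrable_mult_right) (auto simp: has_bochner_integral_iff)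
      have "\<bar>1 - P (u \<delta>) * u' \<delta>\<bar> \<le> C * \<bar>\<delta>\<bar> ^ M"
        using approx[of \<delta>] \<delta> by (simp add: P_def)
      then have "0 \<le> C * \<bar>\<delta>\<bar> ^ M" by linarith
      then have C: "C \<ge> 0" using \<delta> zero_less_power[OF \<delta>, of M] by (simp add: zero_le_mult_iff)
      fix x :: real
      show "\<bar>indicator {-\<delta>..\<delta>} x * ((1 - P (u x) * u' x) * \<gamma> (u x) ^ n)\<bar> \<le> C * (\<bar>x\<bar> ^ M * exp (- real n * (c * x)\<^sup>2 / 2))"
      proof (cases "x \<in> {-\<delta>..\<delta>}")
        case True
        have "(c * x)\<^sup>2 \<le> (u x)\<^sup>2"
          using c(1) c(2)[OF True] by (simp flip: abs_le_square_iff add: abs_mult)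
        then have "\<gamma> (u x) ^ n \<le> exp (- real n * (c * x)\<^sup>2 / 2)"
          unfolding \<gamma>_pow by (simp add: mult_left_mono)
        then have "\<bar>1 - P (u x) * u' x\<bar> * \<gamma> (u x) ^ n \<le> (C * \<bar>x\<bar> ^ M) * exp (- real n * (c * x)\<^sup>2 / 2)"
          using approx[OF True] C unfolding P_def
          by (intro mult_mono) (auto simp: \<gamma>_def)
        then show ?thesis using True by (simp add: abs_mult \<gamma>_pow mult.assoc)
      qed (use C in auto)
    qed
    also have "\<dots> = B * (1 / sqrt (real n) ^ Suc M)"
      using scaled_gaussian_abs_moment[OF n c(1), of M] by (simp add: has_bochner_integral_iff B_def)
    finally have 2: "\<bar>(LINT x:{-\<delta>..\<delta>}|lborel. \<gamma> (u x) ^ n) - (LINT v:{u (-\<delta>)..u \<delta>}|lborel. P v * \<gamma> v ^ n)\<bar>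
        \<le> B * (1 / sqrt (real n) ^ Suc M)"
      unfolding subst .
    have 3: "\<bar>(\<integral>v. P v * \<gamma> v ^ n \<partial>lborel) - (LINT v:{u (-\<delta>)..u \<delta>}|lborel. P v * \<gamma> v ^ n)\<bar> \<le> \<gamma> d ^ (n - 1) * D"
      unfolding D_def
    proof (rule laplace_tail_bound)
      show "\<gamma> v \<le> \<gamma> d" if "v \<notin> {u (-\<delta>)..u \<delta>}" for v
      proof -
        have "\<bar>d\<bar> \<le> \<bar>v\<bar>" using that sgn by (auto simp: d_def)
        then show ?thesis by (simp add: \<gamma>_def abs_le_square_iff)
      qed
      show "integrable lborel (\<lambda>v. P v * \<gamma> v)" using P_int[of 1] by simp
    qed (use n P_int in \<open>auto simp: \<gamma>_def\<close>)
    have "(\<integral>v. P v * \<gamma> v ^ n \<partial>lborel) = (\<integral>v. (\<Sum>j<M. p j * (v ^ j * exp (- real n * v\<^sup>2 / 2))) \<partial>lborel)"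
      by (simp add: P_def \<gamma>_pow sum_distrib_right mult.assoc)
    also have "\<dots> = (\<Sum>j<M. p j * (\<integral>v. v ^ j * exp (- real n * v\<^sup>2 / 2) \<partial>lborel))"
      using has_bochner_integral_gaussian_moment[OF n]
      by (subst Bochner_Integration.integral_sum) (auto simp: has_bochner_integral_iff intro: integrable_mult_right)
    finally show ?thesis
      using 1 2 3 by (simp add: mult.commute)
  qed
  have "(\<lambda>n. (\<integral>x. w x ^ n \<partial>lborel) - (\<Sum>j<M. p j * (\<integral>v. v ^ j * exp (- real n * v\<^sup>2 / 2) \<partial>lborel)))
      \<in> O(\<lambda>n. A * \<rho> ^ (n - 1) + B * (1 / sqrt (real n) ^ Suc M) + D * \<gamma> d ^ (n - 1))"
    by (intro landau_o.big_mono eventually_mono[OF eventually_gt_at_top[of 0]], unfold real_norm_def)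
       (rule order.trans[OF bound abs_ge_self])
  also have "(\<lambda>n. A * \<rho> ^ (n - 1) + B * (1 / sqrt (real n) ^ Suc M) + D * \<gamma> d ^ (n - 1))
      \<in> O(\<lambda>n. 1 / sqrt (real n) ^ Suc M)"
  proof -
    have "\<gamma> d < 1" using d by (simp add: \<gamma>_def)
    then have "(\<lambda>n. \<gamma> d ^ (n - 1)) \<in> O(\<lambda>n. 1 / sqrt (real n) ^ Suc M)"
      by (intro geometric_bigo_power_sqrt) (auto simp: \<gamma>_def)
    moreover have "(\<lambda>n. \<rho> ^ (n - 1)) \<in> O(\<lambda>n. 1 / sqrt (real n) ^ Suc M)"
      using \<rho> by (rule geometric_bigo_power_sqrt)
    moreover have scale: "(\<lambda>n. r * f n) \<in> O(\<lambda>n. 1 / sqrt (real n) ^ Suc M)"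
      if "f \<in> O(\<lambda>n. 1 / sqrt (real n) ^ Suc M)" for r :: real and f
      using that by (cases "r = 0") auto
    moreover have "(\<lambda>n. B * (1 / sqrt (real n) ^ Suc M)) \<in> O(\<lambda>n. 1 / sqrt (real n) ^ Suc M)"
      by (rule scale) (rule landau_o.big_refl)
    ultimately show ?thesis
      by (intro sum_in_bigo) blast+
  qed
  finally show ?thesis .
qed

section \<open>The kernel of the Gamma integral\<close>

text \<open>
  The integrand \<open>t^n e^(-t)\<close> of the Gamma integral becomes, up to a factor independent of \<open>x\<close>, the
  \<open>n\<close>-th power of this function under \<open>t = n (1 + x)\<close>. It is extended by \<open>0\<close> to \<open>x < -1\<close>.
\<close>

definition stirling_kernel :: "real \<Rightarrow> real" where
  "stirling_kernel x = indicator {-1..} x * ((1 + x) * exp (- x))"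

lemma stirling_kernel_nonneg: "0 \<le> stirling_kernel x"
  by (simp add: stirling_kernel_def indicator_def)

lemma has_bochner_integral_stirling_kernel_power:
  assumes "n > 0"
  shows "has_bochner_integral lborel (\<lambda>x. stirling_kernel x ^ n) (fact n * exp (real n) / real n ^ Suc n)"
proof -
  have gamma: "has_bochner_integral lborel (\<lambda>t::real. t ^ n * exp (- t) * indicator {0..} t) (fact n)"
  proof (rule has_bochner_integral_nn_integral)
    have "(\<integral>\<^sup>+t. ennreal (t ^ n * exp (- t) * indicator {0..} t) \<partial>lborel)
        = (\<integral>\<^sup>+t. ennreal (t ^ n * exp (- t)) * indicator {0..} t \<partial>lborel)"
      by (intro nn_integral_cong) (auto simp: indicator_def)
    also have "\<dots> = ennreal (fact n)"
      by (subst nn_intergal_power_times_exp_Ici) simp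
    finally show "(\<integral>\<^sup>+t. ennreal (t ^ n * exp (- t) * indicator {0..} t) \<partial>lborel) = ennreal (fact n)" .
  qed (auto simp: indicator_def)
  have "has_bochner_integral lborel (\<lambda>x. (real n + real n * x) ^ n * exp (- (real n + real n * x)) *
      indicator {0..} (real n + real n * x)) (fact n / real n)"
    using lborel_has_bochner_integral_real_affine_iff[THEN iffD1, OF _ gamma, of "real n" "real n"] assms
    by (simp add: divide_real_def mult.commute[of "inverse (real n)"])
  then have "has_bochner_integral lborel (\<lambda>x. exp (real n) / real n ^ n * ((real n + real n * x) ^ n * 
      exp (- (real n + real n * x)) * indicator {0..} (real n + real n * x))) (exp (real n) / real n ^ n * (fact n / real n))"
    by (rule has_bochner_integral_mult_right)
  moreover have "exp (real n) / real n ^ n * ((real n + real n * x) ^ n * 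
      exp (- (real n + real n * x)) * indicator {0..} (real n + real n * x)) = stirling_kernel x ^ n" for x
  proof -
    have eq: "real n + real n * x = real n * (1 + x)" by (simp add: algebra_simps)
    have ind: "(indicator {0..} (real n + real n * x) :: real) = indicator {-1..} x ^ n"
      using assms unfolding eq by (auto simp: indicator_def zero_le_mult_iff)
    have "exp (- (real n + real n * x)) = exp (- x) ^ n / exp (real n)"
      by (simp add: exp_diff exp_minus field_simps flip: exp_of_nat_mult)
    then show ?thesis
      using assms unfolding ind stirling_kernel_def power_mult_distrib
      unfolding eq power_mult_distrib by simp
  qed
  ultimately show ?thesis
    by (simp add: mult_ac)
qed

lemma stirling_kernel_eq_exp_square:
  assumes "\<bar>x\<bar> < 1"
  shows "stirling_kernel x = exp (- (x * sqrt (L x))\<^sup>2 / 2)"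
proof (cases "x = 0")
  case False
  have "(x * sqrt (L x))\<^sup>2 = x\<^sup>2 * L x"
    using L_pos[OF assms] by (simp add: power_mult_distrib)
  also have "\<dots> = 2 * (x - ln (1 + x))"
    using False by (simp add: L_closed_form[OF assms False])
  finally have "exp (- (x * sqrt (L x))\<^sup>2 / 2) = exp (ln (1 + x) - x)"
    by simp
  also have "\<dots> = (1 + x) * exp (- x)"
    using assms by (simp add: exp_diff exp_minus divide_inverse)
  finally show ?thesis
    using assms by (simp add: stirling_kernel_def)
qed (simp add: stirling_kernel_def)

lemma stirling_kernel_bounded_away:
  assumes "0 < \<delta>" "\<delta> < 1"
  obtains \<rho> where "0 \<le> \<rho>" "\<rho> < 1" "\<And>x. x \<notin> {-\<delta>..\<delta>} \<Longrightarrow> stirling_kernel x \<le> \<rho>"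
proof -
  define g where "g = (\<lambda>x::real. (1 + x) * exp (- x))"
  \<comment> \<open>\<open>g\<close> increases up to \<open>0\<close> and decreases afterwards, so \<open>\<delta>\<close> and \<open>-\<delta>\<close> are the worst points.\<close>
  have dg: "(g has_real_derivative (- x * exp (- x))) (at x)" for x
    unfolding g_def by (auto intro!: derivative_eq_intros simp: algebra_simps)
  have less1: "g x < 1" if "x \<noteq> 0" "\<bar>x\<bar> < 1" for x
  proof -
    have "g x = exp (- (x * sqrt (L x))\<^sup>2 / 2)"
      using stirling_kernel_eq_exp_square[OF that(2)] that(2) by (simp add: stirling_kernel_def g_def)
    then show ?thesis
      using that L_pos[OF that(2)] by simp
  qed
  show ?thesis
  proof (rule that)
    show "0 \<le> max (g \<delta>) (g (-\<delta>))"
      using assms by (auto simp: g_def le_max_iff_disj)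
    show "max (g \<delta>) (g (-\<delta>)) < 1"
      using less1[of \<delta>] less1[of "-\<delta>"] assms by auto
    fix x :: real assume x: "x \<notin> {-\<delta>..\<delta>}"
    have "g x \<le> g \<delta>" if "x > \<delta>"
      using that assms
      by (intro DERIV_nonpos_imp_nonincreasing[of \<delta> x g]) (auto intro!: exI dg)
    moreover have "g x \<le> g (-\<delta>)" if "x < -\<delta>"
      using that assms
      by (intro DERIV_nonneg_imp_nondecreasing[of x "-\<delta>" g]) (auto intro!: exI dg simp: mult_nonpos_nonneg)
    moreover have "stirling_kernel x \<le> max 0 (g x)"
      by (auto simp: stirling_kernel_def g_def indicator_def)
    moreover have "0 \<le> g \<delta>" using assms by (simp add: g_def)
    ultimately show "stirling_kernel x \<le> max (g \<delta>) (g (-\<delta>))"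
      using x by fastforce
  qed
qed

section \<open>The asymptotic expansion of the factorial\<close>

lemma stirling_kernel_integral_expansion:
  assumes s: "(\<lambda>x. sqrt (L x)) has_fps_expansion V"
  shows "(\<lambda>n. (\<integral>x. stirling_kernel x ^ n \<partial>lborel) - 
      (\<Sum>j<M. fps_nth (inverse V ^ Suc j) j * (\<integral>v. v ^ j * exp (- real n * v\<^sup>2 / 2) \<partial>lborel)))
           \<in> O(\<lambda>n. 1 / sqrt (real n) ^ Suc M)"
proof -
  have "fps_nth V 0 = sqrt (L 0)"
    using s by (auto simp: has_fps_expansion_def eval_fps_at_0 dest: eventually_nhds_x_imp_x)
  then have V0: "fps_nth V 0 \<noteq> 0" by (simp add: L_0)
  define U where "U = fps_X * V"
  define P where "P = fps_deriv (fps_inv U)"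
  define u where "u = eval_fps U"
  define u' where "u' = eval_fps (fps_deriv U)"
  have P: "(P oo U) * fps_deriv U = 1" "fps_nth P j = fps_nth (inverse V ^ Suc j) j" for j
    using lagrange_inversion[OF V0] by (simp_all add: U_def P_def)
  have U: "(\<lambda>x. x * sqrt (L x)) has_fps_expansion U"
    unfolding U_def by (intro has_fps_expansion_mult has_fps_expansion_fps_X s)
  then have rad: "fps_conv_radius U > 0" by (simp add: has_fps_expansion_def)
  have rad': "fps_conv_radius (fps_deriv U) > 0"
    using rad fps_conv_radius_deriv[of U] by order
  have expansion: "(\<lambda>x. 1 - (\<Sum>j<M. fps_nth P j * u x ^ j) * u' x) has_fps_expansion
      1 - (\<Sum>j<M. fps_const (fps_nth P j) * U ^ j) * fps_deriv U"
    unfolding u_def u'_def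
    by (intro has_fps_expansion_diff has_fps_expansion_mult has_fps_expansion_sum has_fps_expansion_power
        has_fps_expansion_1 has_fps_expansion_const eval_fps_has_fps_expansion rad rad' has_fps_expansion_cmult_left)
  have vanish: "fps_nth (1 - (\<Sum>j<M. fps_const (fps_nth P j) * U ^ j) * fps_deriv U) i = 0" if "i < M" for i
  proof -
    have "fps_nth (1 :: real fps) i = (\<Sum>j\<le>i. fps_nth P j * fps_nth (U ^ j * fps_deriv U) i)"
      unfolding P(1)[symmetric] by (rule fps_nth_compose_mult) (simp add: U_def)
    also have "\<dots> = (\<Sum>j<M. fps_nth P j * fps_nth (U ^ j * fps_deriv U) i)"
    proof (rule sum.mono_neutral_left)
      show "\<forall>j\<in>{..<M} - {..i}. fps_nth P j * fps_nth (U ^ j * fps_deriv U) i = 0"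
        by (auto simp: U_def power_mult_distrib mult.assoc fps_X_power_mult_nth)
    qed (use that in auto)
    also have "\<dots> = fps_nth ((\<Sum>j<M. fps_const (fps_nth P j) * U ^ j) * fps_deriv U) i"
      by (simp add: sum_distrib_right fps_sum_nth mult.assoc)
    finally show ?thesis by simp
  qed
  obtain C \<delta>1 where C: "\<delta>1 > 0"
    "\<And>x. \<bar>x\<bar> \<le> \<delta>1 \<Longrightarrow> \<bar>1 - (\<Sum>j<M. fps_nth P j * u x ^ j) * u' x\<bar> \<le> C * \<bar>x\<bar> ^ M"
    by (rule has_fps_expansion_zero_prefix_bound[OF expansion, where M = M]) (erule vanish, rule that)
  have "((\<lambda>x. sqrt (L x)) \<longlongrightarrow> sqrt (L 0)) (nhds 0)"
    using has_fps_expansion_imp_continuous[OF s, of UNIV] by (simp add: continuous_within tendsto_nhds_iff)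
  then have "eventually (\<lambda>x. sqrt (L x) > 1 / 2) (nhds 0)"
    by (rule order_tendstoD) (simp add: L_0)
  moreover have "eventually (\<lambda>x. x \<in> eball 0 (fps_conv_radius U)) (nhds (0::real))"
    using rad by (intro eventually_nhds_in_open) (auto simp: zero_ereal_def)
  moreover have "eventually (\<lambda>x. u x = x * sqrt (L x)) (nhds 0)"
    using U by (simp add: has_fps_expansion_def u_def)
  ultimately have "eventually (\<lambda>x. sqrt (L x) > 1 / 2 \<and> x \<in> eball 0 (fps_conv_radius U) \<and> u x = x * sqrt (L x)) (nhds 0)"
    by eventually_elim auto
  then obtain \<delta>2 where \<delta>2: "\<delta>2 > 0" "\<And>x. dist x 0 < \<delta>2 \<Longrightarrow>
      sqrt (L x) > 1 / 2 \<and> x \<in> eball 0 (fps_conv_radius U) \<and> u x = x * sqrt (L x)"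
    unfolding eventually_nhds_metric by blast
  define \<delta> where "\<delta> = Min {\<delta>1, \<delta>2 / 2, 1 / 2}"
  have \<delta>: "\<delta> > 0" "\<delta> \<le> \<delta>1" "\<delta> < \<delta>2" "\<delta> < 1"
    using C(1) \<delta>2(1) by (auto simp: \<delta>_def min_less_iff_disj)
  have near: "sqrt (L x) > 1 / 2" "x \<in> eball 0 (fps_conv_radius U)" "u x = x * sqrt (L x)" "\<bar>x\<bar> < 1" "\<bar>x\<bar> \<le> \<delta>1"
    if "x \<in> {-\<delta>..\<delta>}" for x
    using \<delta>2(2)[of x] \<delta> that by (auto simp: dist_real_def)
  obtain \<rho> where \<rho>: "0 \<le> \<rho>" "\<rho> < 1" "\<And>x. x \<notin> {-\<delta>..\<delta>} \<Longrightarrow> stirling_kernel x \<le> \<rho>"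
    using stirling_kernel_bounded_away[OF \<delta>(1,4)] by blast
  have int: "integrable lborel (\<lambda>x. stirling_kernel x ^ n)" if "n > 0" for n
    using has_bochner_integral_stirling_kernel_power[OF that] by (auto simp: has_bochner_integral_iff)
  show ?thesis
    unfolding P(2)[symmetric]
  proof (rule laplace_expansion[where c = "1 / 2" and u = u and u' = u' and \<delta> = \<delta> and \<rho> = \<rho> and C = C])
    show "stirling_kernel x = exp (- (u x)\<^sup>2 / 2)" if "x \<in> {-\<delta>..\<delta>}" for x
      using stirling_kernel_eq_exp_square near[OF that] by simp
    show "(u has_real_derivative u' x) (at x)" if "x \<in> {-\<delta>..\<delta>}" for x
      unfolding u_def u'_def using near(2)[OF that]
      by (intro has_field_derivative_eval_fps) simp
    show "continuous_on {-\<delta>..\<delta>} u'"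
      unfolding u'_def
    proof (rule continuous_on_subset[OF continuous_on_eval_fps])
      show "{-\<delta>..\<delta>} \<subseteq> eball 0 (fps_conv_radius (fps_deriv U))"
        using near(2) fps_conv_radius_deriv[of U] by (force intro: less_le_trans)
    qed
    show "1 / 2 * \<bar>x\<bar> \<le> \<bar>u x\<bar>" if "x \<in> {-\<delta>..\<delta>}" for x
    proof -
      have "\<bar>u x\<bar> = sqrt (L x) * \<bar>x\<bar>" 
        using near[OF that] L_pos[of x] by (simp add: abs_mult)
      also have "\<dots> \<ge> 1 / 2 * \<bar>x\<bar>"
        using near(1)[OF that] by (intro mult_right_mono) auto
      finally show ?thesis .
    qed
    show "u (-\<delta>) < 0" "0 < u \<delta>"
      using near(1,3)[of \<delta>] near(1,3)[of "-\<delta>"] L_pos[of \<delta>] L_pos[of "-\<delta>"] \<delta>(1,4)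
      by (auto simp: mult_less_0_iff zero_less_mult_iff)
    show "\<bar>1 - (\<Sum>j<M. fps_nth P j * u x ^ j) * u' x\<bar> \<le> C * \<bar>x\<bar> ^ M" if "x \<in> {-\<delta>..\<delta>}" for x
      using C(2) near(5)[OF that] .
  qed (use \<rho> \<delta> int stirling_kernel_nonneg in auto)
qed

text \<open>
  To reach the order \<open>N\<close> in \<open>1 / n\<close>, the Laplace expansion is taken with \<open>M = 2 N + 2\<close>: the error
  \<open>O(n^(-N-3/2))\<close> becomes \<open>O(n^(-N-1))\<close> after division by \<open>sqrt (2 \<pi> / n)\<close>.
\<close>

lemma stirling_expansion_inverse_sqrt_coefficients:
  assumes s: "(\<lambda>x. sqrt (L x)) has_fps_expansion V"
  shows "stirling_expansion (\<lambda>k. fact (2 * k) / (2 ^ k * fact k) * fps_nth (inverse V ^ (2 * k + 1)) (2 * k))"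
    (is "stirling_expansion ?a")
  unfolding stirling_expansion_def
proof (intro allI exI conjI impI)
  fix N :: nat
  define I where "I = (\<lambda>n. \<integral>x. stirling_kernel x ^ n \<partial>lborel)"
  define m where "m = (\<lambda>j n. \<integral>v. v ^ j * exp (- real n * v\<^sup>2 / 2) \<partial>lborel)"
  define E where "E = (\<lambda>n. I n - (\<Sum>j<2*N+2. fps_nth (inverse V ^ Suc j) j * m j n))"
  define R where "R = (\<lambda>n. sqrt (real n / (2 * pi)) * E n)"
  fix n :: nat
  have m: "m j n = (if even j then sqrt (2 * pi / real n) * fact j / (2 ^ (j div 2) * fact (j div 2) * real n ^ (j div 2)) else 0)"
    if "n > 0" for j n
    unfolding m_def using has_bochner_integral_gaussian_moment[OF that] by (rule has_bochner_integral_integral_eq)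
  show "fact n = sqrt (2 * pi * real n) * exp (- real n) * real n ^ n * ((\<Sum>k\<le>N. ?a k / real n ^ k) + R n)" if "n > 0"
  proof -
    have sum_split: "(\<Sum>j<2 * K. f j) = (\<Sum>k<K. f (2 * k) + f (2 * k + 1))" for f :: "nat \<Rightarrow> real" and K
      by (induction K) (simp_all add: algebra_simps)
    have "(\<Sum>j<2*N+2. fps_nth (inverse V ^ Suc j) j * m j n) = (\<Sum>k\<le>N. fps_nth (inverse V ^ (2 * k + 1)) (2 * k) * m (2 * k) n)"
    proof -
      have "(\<Sum>j<2 * Suc N. fps_nth (inverse V ^ Suc j) j * m j n)
          = (\<Sum>k<Suc N. fps_nth (inverse V ^ Suc (2 * k)) (2 * k) * m (2 * k) n
              + fps_nth (inverse V ^ Suc (2 * k + 1)) (2 * k + 1) * m (2 * k + 1) n)"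
        by (rule sum_split)
      moreover have "m (2 * k + 1) n = 0" for k
        using m[OF that] by simp
      ultimately show ?thesis
        by (simp add: lessThan_Suc_atMost del: power_Suc)
    qed
    also have "\<dots> = sqrt (2 * pi / real n) * (\<Sum>k\<le>N. ?a k / real n ^ k)"
      unfolding sum_distrib_left using m[OF that] by (intro sum.cong refl) simp
    finally have "I n = sqrt (2 * pi / real n) * (\<Sum>k\<le>N. ?a k / real n ^ k) + E n"
      by (simp add: E_def)
    moreover have "E n = sqrt (2 * pi / real n) * R n"
      using that by (simp add: R_def flip: mult.assoc real_sqrt_mult)
    ultimately have I: "I n = sqrt (2 * pi / real n) * ((\<Sum>k\<le>N. ?a k / real n ^ k) + R n)"
      by (simp add: algebra_simps)
    have "I n = fact n * exp (real n) / real n ^ Suc n"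
      unfolding I_def using has_bochner_integral_stirling_kernel_power[OF that] by (rule has_bochner_integral_integral_eq)
    then have "fact n = real n * I n * exp (- real n) * real n ^ n"
      using that by (simp add: exp_minus field_simps)
    also have "real n * I n = sqrt (2 * pi * real n) * ((\<Sum>k\<le>N. ?a k / real n ^ k) + R n)"
    proof -
      have "real n * sqrt (2 * pi / real n) = sqrt (2 * pi * real n)"
        using that by (simp add: real_sqrt_divide real_sqrt_mult field_simps)
      then show ?thesis unfolding I mult.assoc[symmetric] by simp
    qed
    finally show ?thesis by (simp add: mult_ac)
  qed
  have "E \<in> O(\<lambda>n. 1 / sqrt (real n) ^ Suc (2*N+2))"
    unfolding E_def I_def m_def using s by (rule stirling_kernel_integral_expansion)
  then have "R \<in> O(\<lambda>n. sqrt (real n / (2 * pi)) * (1 / sqrt (real n) ^ Suc (2*N+2)))"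
    unfolding R_def by (intro landau_o.big.mult_left)
  also have "(\<lambda>n. sqrt (real n / (2 * pi)) * (1 / sqrt (real n) ^ Suc (2*N+2))) \<in> O(\<lambda>n. 1 / real n ^ (N + 1))"
  proof (rule bigoI[of _ "1 / sqrt (2 * pi)"], rule eventually_mono[OF eventually_gt_at_top[of 0]])
    fix n :: nat assume "n > 0"
    have "sqrt (real n) ^ (2*N+2) = (sqrt (real n) ^ 2) ^ (N + 1)"
      by (subst power_mult[symmetric]) simp
    then have "sqrt (real n) ^ (2*N+2) = real n ^ (N + 1)"
      by simp
    then show "norm (sqrt (real n / (2 * pi)) * (1 / sqrt (real n) ^ Suc (2*N+2))) \<le> 1 / sqrt (2 * pi) * norm (1 / real n ^ (N + 1))"
      using \<open>n > 0\<close> by (simp add: real_sqrt_divide)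
  qed
  finally show "R \<in> O(\<lambda>n. 1 / real n ^ (N + 1))" .
qed

text \<open>
  Let \<open>k\<close> be the first index at which the two sequences might differ. Comparing the expansions with
  \<open>N = k\<close> gives \<open>(a k - b k) / n^k = O(1 / n^(k+1))\<close>.
\<close>

lemma stirling_expansion_unique:
  assumes a: "stirling_expansion a" and b: "stirling_expansion b"
  shows "a = b"
proof
  fix k show "a k = b k"
  proof (induction k rule: less_induct)
    case (less k)
    obtain R where R: "\<forall>n>0. fact n = sqrt (2 * pi * real n) * exp (- real n) * real n ^ n * ((\<Sum>i\<le>k. a i / real n ^ i) + R n)"
      "R \<in> O(\<lambda>n. 1 / real n ^ (k + 1))"
      using a unfolding stirling_expansion_def by blast
    obtain S where S: "\<forall>n>0. fact n = sqrt (2 * pi * real n) * exp (- real n) * real n ^ n * ((\<Sum>i\<le>k. b i / real n ^ i) + S n)"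
      "S \<in> O(\<lambda>n. 1 / real n ^ (k + 1))"
      using b unfolding stirling_expansion_def by blast
    have "eventually (\<lambda>n. S n - R n = (a k - b k) * (1 / real n ^ k)) sequentially"
      using eventually_gt_at_top[of 0]
    proof eventually_elim
      case (elim n)
      have "(\<Sum>i\<le>k. a i / real n ^ i) + R n = (\<Sum>i\<le>k. b i / real n ^ i) + S n"
        using R(1)[rule_format, OF elim] S(1)[rule_format, OF elim] elim by simp
      moreover have "(\<Sum>i<k. a i / real n ^ i) = (\<Sum>i<k. b i / real n ^ i)"
        using less by (intro sum.cong) auto
      ultimately show ?case
        by (simp add: lessThan_Suc_atMost[symmetric] diff_divide_distrib)
    qed
    moreover have "(\<lambda>n. S n - R n) \<in> O(\<lambda>n. 1 / real n ^ (k + 1))"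
      using S(2) R(2) by (rule sum_in_bigo)
    ultimately have "(\<lambda>n. (a k - b k) * (1 / real n ^ k)) \<in> O(\<lambda>n. 1 / real n ^ (k + 1))"
      by (subst (asm) landau_o.big.in_cong) auto
    moreover have "(\<lambda>n. 1 / real n ^ (k + 1)) \<in> o(\<lambda>n. 1 / real n ^ k)"
      by real_asymp
    ultimately have "(\<lambda>n. (a k - b k) * (1 / real n ^ k)) \<in> o(\<lambda>n. 1 / real n ^ k)"
      by (rule landau_o.big_small_trans)
    then have "a k - b k = 0 \<or> (\<lambda>n. 1 / real n ^ k) \<in> o(\<lambda>n. 1 / real n ^ k)"
      using landau_o.small.cmult_in_iff[of "a k - b k"] by blast
    moreover have "\<not> (\<lambda>n. 1 / real n ^ k) \<in> o(\<lambda>n. 1 / real n ^ k)"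
      by (subst landau_o.small_refl_iff) (auto intro!: eventually_frequently eventually_mono[OF eventually_gt_at_top[of 0]] simp: not_eventually)
    ultimately show ?case by simp
  qed
qed

theorem theorem2p7:
  fixes a :: "nat \<Rightarrow> real"
  shows "stirling_expansion a \<longleftrightarrow>
    (\<forall>k. a k = 1 / (2 ^ k * fact k) *
       (deriv ^^ (2 * k)) (\<lambda>x. L x powr (- (2 * real k + 1) / 2)) 0)"
proof -
  obtain V where V: "(\<lambda>x. sqrt (L x)) has_fps_expansion V"
    by (rule sqrt_L_has_fps_expansion)
  define b where "b = (\<lambda>k. 1 / (2 ^ k * fact k) * (deriv ^^ (2 * k)) (\<lambda>x. L x powr (- (2 * real k + 1) / 2)) 0)"
  have "stirling_expansion b"
    using stirling_expansion_inverse_sqrt_coefficients[OF V]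
    by (simp only: b_def higher_deriv_L_powr[OF V] times_divide_eq_left mult_1_left)
  then have "stirling_expansion a \<longleftrightarrow> a = b"
    using stirling_expansion_unique by blast
  then show ?thesis
    by (simp only: b_def fun_eq_iff)
qed

end
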